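(* Let $q$ be a power of an odd prime. Then the polynomials \begin{enumerate} \item $X^2-X^{q+1}-X^{q^2+1}+X^{2q}+X^{2q^2}$ and \item $X^2+X^{q+1}+X^{q^2+1}+\tfrac12 X^{2q}+\tfrac12 X^{2q^2}$ \end{enumerate} are planar over $\mathbb{F}_{q^3}$.
   Context: For $q$ odd, a function $f:\mathbb{F}_{q^n}\to\mathbb{F}_{q^n}$ is called planar (over $\mathbb{F}_{q^n}$) if for every $\epsilon\in\mathbb{F}_{q^n}^*$ the polynomial $f(X+\epsilon)-f(X)$ induces a permutation of $\mathbb{F}_{q^n}$. *)

theory Defs
  imports "HOL-Library.Cardinality" "HOL-Computational_Algebra.Computational_Algebra"
begin

(* The finite field is the whole type 'a. The notion is used in odd characteristic only. *)
definition planar :: "('a :: {field, finite} \<Rightarrow> 'a) \<Rightarrow> bool" where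
  "planar f \<longleftrightarrow> (\<forall>\<epsilon>. \<epsilon> \<noteq> 0 \<longrightarrow> bij (\<lambda>x. f (x + \<epsilon>) - f x))"

end

theory Submission
  imports Defs
begin

text \<open>
  Both polynomials are quadratic forms in \<open>x, \<sigma> x, \<sigma> (\<sigma> x)\<close>, where \<open>\<sigma>\<close> is the Frobenius map
  \<open>x \<mapsto> x ^ q\<close>, which has order three. Planarity therefore says that for \<open>\<epsilon> \<noteq> 0\<close> the additive map
  obtained by polarising the form at \<open>\<epsilon>\<close> has trivial kernel. A kernel element \<open>d\<close> satisfies the
  polarised equation and its two conjugates, a \<open>3 \<times> 3\<close> linear system in \<open>d, \<sigma> d, \<sigma> (\<sigma> d)\<close>. With
  \<open>a, b, c\<close> the conjugates of \<open>\<epsilon>\<close>, its determinant is \<open>2 (a + b - c) (a - b + c) (b + c - a)\<close> for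
  the first form and \<open>4 (a + b) (a + c) (b + c)\<close> for the second. In each case the linear factors
  are conjugate, and they do not vanish when \<open>\<epsilon> \<noteq> 0\<close>.
\<close>

text \<open>On a finite type injectivity suffices. With the second point written as
  \<open>x + d\<close>, a quadratic form loses its terms in \<open>x\<close> and leaves a condition
  on \<open>d\<close> alone.\<close>

lemma planarI:
  fixes f :: "'a :: {field, finite} \<Rightarrow> 'a"
  assumes "\<And>\<epsilon> x d. \<epsilon> \<noteq> 0 \<Longrightarrow> f (x + d + \<epsilon>) - f (x + d) = f (x + \<epsilon>) - f x \<Longrightarrow> d = 0"
  shows "planar f"
  unfolding planar_def
proof (intro allI impI)
  fix \<epsilon> :: 'a assume "\<epsilon> \<noteq> 0"
  have "inj (\<lambda>x. f (x + \<epsilon>) - f x)"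
  proof (rule injI)
    fix x y assume "f (x + \<epsilon>) - f x = f (y + \<epsilon>) - f y"
    with assms[OF \<open>\<epsilon> \<noteq> 0\<close>, of y "x - y"] show "x = y" by simp
  qed
  then show "bij (\<lambda>x. f (x + \<epsilon>) - f x)"
    by (simp add: bij_def finite_UNIV_inj_surj)
qed

locale order_three_automorphism =
  fixes \<sigma> :: "'a :: field \<Rightarrow> 'a"
  assumes add: "\<sigma> (x + y) = \<sigma> x + \<sigma> y"
    and mult: "\<sigma> (x * y) = \<sigma> x * \<sigma> y"
    and cube: "\<sigma> (\<sigma> (\<sigma> x)) = x"
    and two_neq_0: "(2 :: 'a) \<noteq> 0"
begin

lemma zero: "\<sigma> 0 = 0"
  by (metis add add.right_neutral add_left_cancel)

lemma uminus: "\<sigma> (- x) = - \<sigma> x"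
  using add[of x "- x"] zero by (simp add: add_eq_0_iff)

lemma diff: "\<sigma> (x - y) = \<sigma> x - \<sigma> y"
  using add[of x "- y"] uminus by simp

lemma one: "\<sigma> 1 = 1"
  by (metis cube mult mult.left_neutral mult.right_neutral)

lemma two: "\<sigma> 2 = 2"
  using add[of 1 1] by (simp add: one)

lemmas hom_simps = add diff two mult cube

lemma eq_0_iff: "\<sigma> x = 0 \<longleftrightarrow> x = 0"
  by (metis cube zero)

lemma add_conj_neq_0:
  assumes "x \<noteq> 0"
  shows "x + \<sigma> x \<noteq> 0"
proof
  assume "x + \<sigma> x = 0"
  then have *: "\<sigma> x = - x" by (simp add: add_eq_0_iff)
  \<comment> \<open>Three sign changes, an odd number, give
    \<open>x = \<sigma> (\<sigma> (\<sigma> x)) = - x\<close>.\<close>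
  then have "x = - x" by (metis cube uminus minus_minus)
  then have "2 * x = 0" by (metis mult_2 add_eq_0_iff minus_minus)
  with two_neq_0 assms show False by simp
qed

text \<open>The expression and its conjugate add up to \<open>2 * \<sigma> x\<close>.\<close>

lemma add_conj_diff_neq_0:
  assumes "x \<noteq> 0"
  shows "x + \<sigma> x - \<sigma> (\<sigma> x) \<noteq> 0"
proof
  assume *: "x + \<sigma> x - \<sigma> (\<sigma> x) = 0"
  then have "\<sigma> (x + \<sigma> x - \<sigma> (\<sigma> x)) = 0" by (simp only: zero)
  then have "\<sigma> x + \<sigma> (\<sigma> x) - x = 0" by (simp only: hom_simps)
  moreover have "2 * \<sigma> x = (x + \<sigma> x - \<sigma> (\<sigma> x)) + (\<sigma> x + \<sigma> (\<sigma> x) - x)"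
    by simp
  ultimately have "2 * \<sigma> x = 0" using * by simp
  with two_neq_0 assms show False by (simp add: eq_0_iff)
qed

lemma polar1_eq_0:
  assumes "e \<noteq> 0"
    and "(2 * e - \<sigma> e - \<sigma> (\<sigma> e)) * d + (2 * \<sigma> e - e) * \<sigma> d + (2 * \<sigma> (\<sigma> e) - e) * \<sigma> (\<sigma> d) = 0"
      (is "?L = 0")
  shows "d = 0"
proof -
  define a b c where "a = e" and "b = \<sigma> e" and "c = \<sigma> (\<sigma> e)"
  define y z where "y = \<sigma> d" and "z = \<sigma> (\<sigma> d)"
  have 1: "(2 * a - b - c) * d + (2 * b - a) * y + (2 * c - a) * z = 0"
    using assms(2) by (simp only: a_def b_def c_def y_def z_def)
  have "\<sigma> ?L = 0" by (simp only: assms(2) zero)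
  then have 2: "(2 * b - c - a) * y + (2 * c - b) * z + (2 * a - b) * d = 0"
    by (simp only: hom_simps a_def b_def c_def y_def z_def)
  have "\<sigma> (\<sigma> ?L) = 0" by (simp only: assms(2) zero)
  then have 3: "(2 * c - a - b) * z + (2 * a - c) * d + (2 * b - c) * y = 0"
    by (simp only: hom_simps a_def b_def c_def y_def z_def)
  \<comment> \<open>Cramer's rule: the cofactors of the \<open>d\<close> column eliminate
    \<open>y\<close> and \<open>z\<close>.\<close>
  have "2 * ((a + b - c) * ((b + c - a) * (c + a - b))) * d = 0"
    using 1 2 3 by algebra
  moreover have "a + b - c \<noteq> 0" "b + c - a \<noteq> 0" "c + a - b \<noteq> 0"
    using add_conj_diff_neq_0[of a] add_conj_diff_neq_0[of b] add_conj_diff_neq_0[of c] \<open>e \<noteq> 0\<close>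
    by (simp_all add: a_def b_def c_def cube eq_0_iff)
  ultimately show ?thesis using two_neq_0 by simp
qed

lemma polar2_eq_0:
  assumes "e \<noteq> 0"
    and "(2 * e + \<sigma> e + \<sigma> (\<sigma> e)) * d + (e + \<sigma> e) * \<sigma> d + (e + \<sigma> (\<sigma> e)) * \<sigma> (\<sigma> d) = 0"
      (is "?L = 0")
  shows "d = 0"
proof -
  define a b c where "a = e" and "b = \<sigma> e" and "c = \<sigma> (\<sigma> e)"
  define y z where "y = \<sigma> d" and "z = \<sigma> (\<sigma> d)"
  have 1: "(2 * a + b + c) * d + (a + b) * y + (a + c) * z = 0"
    using assms(2) by (simp only: a_def b_def c_def y_def z_def)
  have "\<sigma> ?L = 0" by (simp only: assms(2) zero)
  then have 2: "(2 * b + c + a) * y + (b + c) * z + (b + a) * d = 0"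
    by (simp only: hom_simps a_def b_def c_def y_def z_def)
  have "\<sigma> (\<sigma> ?L) = 0" by (simp only: assms(2) zero)
  then have 3: "(2 * c + a + b) * z + (c + a) * d + (c + b) * y = 0"
    by (simp only: hom_simps a_def b_def c_def y_def z_def)
  \<comment> \<open>The constant 4 is split into two factors 2, so that \<open>two_neq_0\<close>
    disposes of it.\<close>
  have "2 * (2 * ((a + b) * ((b + c) * (c + a)))) * d = 0"
    using 1 2 3 by algebra
  moreover have "a + b \<noteq> 0" "b + c \<noteq> 0" "c + a \<noteq> 0"
    using add_conj_neq_0[of a] add_conj_neq_0[of b] add_conj_neq_0[of c] \<open>e \<noteq> 0\<close>
    by (simp_all add: a_def b_def c_def cube eq_0_iff)
  ultimately show ?thesis using two_neq_0 by (metis mult_eq_0_iff)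
qed

end

lemma planar_form1:
  fixes \<sigma> :: "'a :: {field, finite} \<Rightarrow> 'a"
  assumes "order_three_automorphism \<sigma>"
  shows "planar (\<lambda>x. x\<^sup>2 - x * \<sigma> x - x * \<sigma> (\<sigma> x) + (\<sigma> x)\<^sup>2 + (\<sigma> (\<sigma> x))\<^sup>2)"
    (is "planar ?f")
proof (rule planarI)
  interpret order_three_automorphism \<sigma> by fact
  fix \<epsilon> x d
  assume "\<epsilon> \<noteq> 0" and eq: "?f (x + d + \<epsilon>) - ?f (x + d) = ?f (x + \<epsilon>) - ?f x"
  show "d = 0"
  proof (rule polar1_eq_0[OF \<open>\<epsilon> \<noteq> 0\<close>])
    show "(2 * \<epsilon> - \<sigma> \<epsilon> - \<sigma> (\<sigma> \<epsilon>)) * d + (2 * \<sigma> \<epsilon> - \<epsilon>) * \<sigma> d + (2 * \<sigma> (\<sigma> \<epsilon>) - \<epsilon>) * \<sigma> (\<sigma> d) = 0"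
      \<comment> \<open>The second difference in \<open>eq\<close> is the polar form, biadditive in
        \<open>\<epsilon>\<close> and \<open>d\<close>.\<close>
      using eq unfolding add by algebra
  qed
qed

lemma planar_form2:
  fixes \<sigma> :: "'a :: {field, finite} \<Rightarrow> 'a"
  assumes "order_three_automorphism \<sigma>"
  shows "planar (\<lambda>x. x\<^sup>2 + x * \<sigma> x + x * \<sigma> (\<sigma> x) + 1/2 * (\<sigma> x)\<^sup>2 + 1/2 * (\<sigma> (\<sigma> x))\<^sup>2)"
    (is "planar ?f")
proof (rule planarI)
  interpret order_three_automorphism \<sigma> by fact
  fix \<epsilon> x d
  assume "\<epsilon> \<noteq> 0" and eq: "?f (x + d + \<epsilon>) - ?f (x + d) = ?f (x + \<epsilon>) - ?f x"
  \<comment> \<open>With 1/2 named, \<open>algebra\<close> needs only the polynomial relation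
    \<open>2 * h = 1\<close>.\<close>
  define h :: 'a where "h = 1/2"
  have h: "2 * h = 1" using two_neq_0 by (simp add: h_def)
  show "d = 0"
  proof (rule polar2_eq_0[OF \<open>\<epsilon> \<noteq> 0\<close>])
    show "(2 * \<epsilon> + \<sigma> \<epsilon> + \<sigma> (\<sigma> \<epsilon>)) * d + (\<epsilon> + \<sigma> \<epsilon>) * \<sigma> d + (\<epsilon> + \<sigma> (\<sigma> \<epsilon>)) * \<sigma> (\<sigma> d) = 0"
      using eq h unfolding add h_def[symmetric] by algebra
  qed
qed

text \<open>
  The library states this for the class \<open>finite_field\<close>, which the sort \<open>{field, finite}\<close> is not
  known to be contained in.
\<close>
lemma power_CARD_eq_same:
  fixes x :: "'a :: {field, finite}"
  shows "x ^ CARD('a) = x"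
proof (cases "x = 0")
  case False
  \<comment> \<open>Multiplication by \<open>x\<close> permutes the nonzero elements, whose product
    is nonzero and cancels.\<close>
  have "(\<Prod>y\<in>UNIV - {0}. x * y) = \<Prod>(UNIV - {0})"
    by (rule prod.reindex_bij_witness[of _ "\<lambda>y. y / x" "\<lambda>y. x * y"]) (use False in auto)
  then have "x ^ (CARD('a) - 1) = 1"
    by (simp add: prod.distrib)
  then show ?thesis
    by (metis finite_UNIV_card_ge_0 finite mult.right_neutral power_eq_if neq0_conv)
qed simp

text \<open>Translation by 1 permutes the ring and so preserves the sum of all elements.\<close>

lemma of_nat_CARD_eq_0: "of_nat CARD('a :: {ring_1, finite}) = (0 :: 'a)"
proof -
  have "(\<Sum>x\<in>UNIV. x + 1) = (\<Sum>x\<in>UNIV. x :: 'a)"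
    by (rule sum.reindex_bij_witness[of _ "\<lambda>x. x - 1" "\<lambda>x. x + 1"]) auto
  then show ?thesis
    by (simp add: sum.distrib)
qed

text \<open>The characteristic is a prime that divides the order of the field.\<close>

lemma CHAR_eq_prime_if_CARD_eq_power:
  assumes "prime p" and "CARD('a :: {field, finite}) = p ^ n"
  shows "CHAR('a) = p"
proof -
  have "prime CHAR('a)"
    by (simp add: prime_CHAR_semidom finite_imp_CHAR_pos)
  then show ?thesis
    using of_nat_CARD_eq_0[where ?'a = 'a] assms
    by (metis of_nat_eq_0_iff_char_dvd prime_dvd_power primes_dvd_imp_eq)
qed

text \<open>Additivity holds as \<open>q\<close> is a power of the characteristic;
  \<open>x ^ (q ^ 3) = x\<close> gives order three.\<close>

lemma order_three_automorphism_Frobenius: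
  assumes "prime p" and "odd p" and "q = p ^ k"
    and card: "CARD('a :: {field, finite}) = q ^ 3"
  shows "order_three_automorphism (\<lambda>x :: 'a. x ^ q)"
proof
  have char: "CHAR('a) = p"
    using assms by (intro CHAR_eq_prime_if_CARD_eq_power) (simp_all flip: power_mult)
  show "(x + y) ^ q = x ^ q + y ^ q" for x y :: 'a
    by (rule freshmans_dream') (use assms char in auto)
  show "((x ^ q) ^ q) ^ q = x" for x :: 'a
    using power_CARD_eq_same[of x] by (simp add: card power3_eq_cube power_mult)
  have "\<not> p dvd 2"
    using \<open>prime p\<close> \<open>odd p\<close> by (metis primes_dvd_imp_eq two_is_prime_nat dvd_refl)
  then show "(2 :: 'a) \<noteq> 0"
    using of_nat_eq_0_iff_char_dvd[where ?'a = 'a, of 2] char by simp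
qed (rule power_mult_distrib)

theorem theorem3p4:
  fixes p k q :: nat
  assumes "prime p" and "odd p" and "k \<ge> 1" and "q = p ^ k"
    and "CARD('a :: {field, finite}) = q ^ 3"
  shows "planar (poly (monom 1 2 - monom 1 (q + 1) - monom 1 (q^2 + 1)
                        + monom 1 (2 * q) + monom 1 (2 * q^2) :: 'a poly))
       \<and> planar (poly (monom 1 2 + monom 1 (q + 1) + monom 1 (q^2 + 1)
                        + monom (1/2) (2 * q) + monom (1/2) (2 * q^2) :: 'a poly))"
    (is "planar (poly ?F) \<and> planar (poly ?G)")
proof -
  have \<sigma>: "order_three_automorphism (\<lambda>x :: 'a. x ^ q)"
    using assms by (intro order_three_automorphism_Frobenius)
  \<comment> \<open>Exponents become iterates of \<open>x ^ q\<close>, to match the two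
    forms.\<close>
  have powers: "x ^ (q\<^sup>2) = (x ^ q) ^ q" "x ^ (2 * q) = (x ^ q)\<^sup>2" "x ^ (2 * q\<^sup>2) = ((x ^ q) ^ q)\<^sup>2"
    for x :: 'a
    by (simp_all add: power2_eq_square power_mult mult_2 power_add)
  have "poly ?F = (\<lambda>x. x\<^sup>2 - x * x ^ q - x * (x ^ q) ^ q + (x ^ q)\<^sup>2 + ((x ^ q) ^ q)\<^sup>2)"
    by (rule ext) (simp add: poly_monom powers)
  moreover have "poly ?G =
      (\<lambda>x. x\<^sup>2 + x * x ^ q + x * (x ^ q) ^ q + 1/2 * (x ^ q)\<^sup>2 + 1/2 * ((x ^ q) ^ q)\<^sup>2)"
    by (rule ext) (simp add: poly_monom powers)
  ultimately show ?thesis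
    using planar_form1[OF \<sigma>] planar_form2[OF \<sigma>] by (simp only: simp_thms)
qed

end
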